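(* Let $G$ be a connected graph with $|L(G)|\geq 4$, and let $i\in\{0,1,2\}$. Assume that it is not the case that simultaneously $i=0$, $|L_o(G)|=3$ and $|L_e(G)|=2$. If $w(G)\leq |L(G)|+i$, then $\chi(G)\leq |L(G)|+i$.
   Context: All graphs are finite, simple and undirected. $L(G)$ denotes the set of all integers $m$ such that $G$ contains a cycle of length $m$; $L_o(G)$ and $L_e(G)$ denote the sets of odd, respectively even, elements of $L(G)$. $w(G)$ denotes the clique number of $G$ (the number of vertices of a largest clique) and $\chi(G)$ the chromatic number. *)

theory Defs
  imports "Graph_Theory.Digraph_Component"
begin

(* A finite simple undirected graph is a pair_graph: finitely many vertices, no loops, and
   each edge uv given by both arcs (u,v) and (v,u). *)

(* The bound 3 excludes the walks u,v,u along a single edge, which are cycles of the digraph. *)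
definition cycle_lengths :: "'a pair_pre_digraph \<Rightarrow> nat set" where
  "cycle_lengths G = {length p | p. pre_digraph.cycle (with_proj G) p \<and> 3 \<le> length p}"

definition odd_cycle_lengths :: "'a pair_pre_digraph \<Rightarrow> nat set" where
  "odd_cycle_lengths G = {m \<in> cycle_lengths G. odd m}"

definition even_cycle_lengths :: "'a pair_pre_digraph \<Rightarrow> nat set" where
  "even_cycle_lengths G = {m \<in> cycle_lengths G. even m}"

definition clique :: "'a pair_pre_digraph \<Rightarrow> 'a set \<Rightarrow> bool" where
  "clique G C \<longleftrightarrow> C \<subseteq> pverts G \<and> (\<forall>u\<in>C. \<forall>v\<in>C. u \<noteq> v \<longrightarrow> (u, v) \<in> parcs G)"

definition clique_number :: "'a pair_pre_digraph \<Rightarrow> nat" where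
  "clique_number G = Max {card C | C. clique G C}"

definition proper_colouring :: "'a pair_pre_digraph \<Rightarrow> nat \<Rightarrow> ('a \<Rightarrow> nat) \<Rightarrow> bool" where
  "proper_colouring G k c \<longleftrightarrow>
     (\<forall>v\<in>pverts G. c v < k) \<and> (\<forall>(u, v)\<in>parcs G. c u \<noteq> c v)"

definition chromatic_number :: "'a pair_pre_digraph \<Rightarrow> nat" where
  "chromatic_number G = (LEAST k. \<exists>c. proper_colouring G k c)"

(* The three lemmas below show that Max, LEAST and the cardinality of cycle_lengths are taken
   over sets on which they have their intended meaning. *)

lemma finite_cycle_lengths:
  assumes "pair_graph G"
  shows "finite (cycle_lengths G)"
proof (rule finite_subset)
  interpret pair_graph G by fact
  show "cycle_lengths G \<subseteq> {..card (pverts G)}"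
  proof
    fix m assume "m \<in> cycle_lengths G"
    then obtain p u where m: "m = length p" and p: "awalk u p u"
        "distinct (tl (pawalk_verts u p))"
      unfolding cycle_lengths_def by (auto simp: cycle_def)
    have "set (tl (pawalk_verts u p)) \<subseteq> pverts G"
      using p(1) by (auto elim!: awalkE' dest: list.set_sel(2)[rotated])
    moreover have "length (tl (pawalk_verts u p)) = length p"
      using length_awalk_verts[of u p] by simp
    ultimately show "m \<in> {..card (pverts G)}"
      using p(2) m by (metis atMost_iff card_mono distinct_card pair_finite_verts)
  qed
qed simp

lemma finite_clique_sizes:
  assumes "pair_graph G"
  shows "finite {card C | C. clique G C}" "{card C | C. clique G C} \<noteq> {}"
proof -
  interpret pair_graph G by fact
  have "{C. clique G C} \<subseteq> Pow (pverts G)"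
    by (auto simp: clique_def)
  then have "finite {C. clique G C}"
    using pair_finite_verts by (meson finite_Pow_iff finite_subset)
  then show "finite {card C | C. clique G C}" by simp
  have "clique G {}" by (simp add: clique_def)
  then show "{card C | C. clique G C} \<noteq> {}" by blast
qed

lemma proper_colouring_exists:
  assumes "pair_graph G"
  shows "\<exists>k c. proper_colouring G k c"
proof -
  interpret pair_graph G by fact
  obtain c :: "'a \<Rightarrow> nat" and k where c: "c ` pverts G = {i. i < k}" "inj_on c (pverts G)"
    using finite_imp_inj_to_nat_seg[OF pair_finite_verts] by auto
  have "proper_colouring G k c"
    unfolding proper_colouring_def
    using c pair_no_loops in_arcsD1 in_arcsD2 by (fastforce dest: inj_onD)
  then show ?thesis by blast
qed

end

theory Submission
  imports Defs
begin

text \<open>Let \<open>d = |L(G)| + i \<ge> 4\<close> and suppose that \<open>G\<close> is not \<open>d\<close>-colourable; a vertex-critical induced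
  subgraph has minimum degree at least \<open>d\<close>, and we find \<open>d + 1\<close> pairwise adjacent vertices in it.

  The first vertex of a longest path \<open>f\<close> has its at least \<open>d\<close> neighbours on the path. If they are the
  \<open>f (j + 1)\<close> with \<open>j \<in> S\<close>, then every positive difference \<open>m\<close> of elements of \<open>S\<close> gives a cycle of
  length \<open>m + 2\<close>. Hence \<open>S\<close> is contained in a set \<open>M\<close> of size \<open>d + 1\<close>, omits at most one element
  of it, and has all its differences in \<open>M\<close>. On the other hand, heights in a depth-first search tree
  give a homomorphism to the distance graph on the integers with distances \<open>m + 1\<close>, \<open>m \<in> M\<close>. So
  the graph is 4-colourable if \<open>M\<close> consists of multiples of some \<open>p \<ge> 2\<close> or has at most one odd element.
  Together with the 4- and 6-cycles that arise from rotating the path, this leaves only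
  \<open>M = {0, \<dots>, d - 1, t}\<close>. If \<open>t > d + 1\<close>, then all longest paths start with a clique; if
  \<open>t = d + 1\<close>, a forbidden cycle of length \<open>d + 2\<close> appears otherwise; and if \<open>t = d\<close>, criticality
  forces the graph to have \<open>d + 2\<close> vertices.\<close>

section \<open>Sets of integers with few differences\<close>

text \<open>With \<open>q\<close> the least non-member, fewer than two elements above
  \<open>q\<close> would give \<open>M\<close> the excluded shape; \<open>u\<close> and
  \<open>v\<close> are the two smallest elements above \<open>q\<close>.\<close>

lemma two_above_gap:
  fixes M :: "nat set"
  assumes "finite M" and no: "\<not> (\<exists>t \<ge> card M - 1. M \<subseteq> insert t {..<card M - 1})"
  shows "\<exists>q u v. {..<q} \<subseteq> M \<and> q \<notin> M \<and> u \<in> M \<and> v \<in> M \<and> q < u \<and> u < v \<and>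
    (\<forall>m\<in>M. m < v \<longrightarrow> m < q \<or> m = u)"
proof -
  define q where "q = (LEAST q. q \<notin> M)"
  obtain q0 where "q0 \<notin> M" using assms(1) ex_new_if_finite infinite_UNIV_nat by blast
  then have q: "q \<notin> M" unfolding q_def by (rule LeastI)
  have low: "{..<q} \<subseteq> M" unfolding q_def using not_less_Least by blast
  define A where "A = {m \<in> M. q < m}"
  have finA: "finite A" using assms(1) by (simp add: A_def)
  have M: "M = {..<q} \<union> A" using low q unfolding A_def
    by (auto simp: not_less)
  have cM: "card M = q + card A"
    using finA unfolding M by (subst card_Un_disjoint) (auto simp: A_def)
  have "card A \<noteq> 0"
  proof
    assume "card A = 0"
    then have "A = {}" using finA by simp
    then have "M \<subseteq> insert (q - 1) {..<card M - 1}" "q - 1 \<ge> card M - 1"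
      using M cM by auto
    then show False using no by blast
  qed
  moreover have "card A \<noteq> 1"
  proof
    assume c: "card A = 1"
    then obtain t where t: "A = {t}" using card_1_singletonE by blast
    have cM': "card M - 1 = q" using cM c by simp
    have "q < t" using t unfolding A_def by blast
    then have "card M - 1 \<le> t" "M \<subseteq> insert t {..<card M - 1}"
      unfolding cM' using M t by simp_all
    then show False using no by blast
  qed
  ultimately have cA: "2 \<le> card A" by linarith
  define u where "u = Min A"
  have Ane: "A \<noteq> {}" using cA by auto
  have u: "u \<in> A" unfolding u_def using finA Ane by simp
  have "card (A - {u}) \<ge> 1" using cA u finA by simp
  then have Bne: "A - {u} \<noteq> {}" by (metis card.empty not_one_le_zero)
  define v where "v = Min (A - {u})"
  have v: "v \<in> A - {u}" unfolding v_def using finA Bne by (intro Min_in) auto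
  have "u \<le> v" using v finA unfolding u_def by auto
  then have uv: "u < v" using v by auto
  have "m < q \<or> m = u" if "m \<in> M" "m < v" for m
  proof (rule ccontr)
    assume "\<not> ?thesis"
    then have "m \<in> A - {u}" using that q M by auto
    then have "v \<le> m" unfolding v_def using finA by auto
    then show False using that by simp
  qed
  then show ?thesis using low q u v uv by (intro exI[of _ q] exI[of _ u] exI[of _ v]) (auto simp: A_def)
qed

text \<open>Only the pair \<open>(y, z)\<close> may have its difference outside \<open>M\<close>. A
  non-multiple of the smallest positive element \<open>p\<close>, or a gap if \<open>p = 1\<close>,
  already uses up this pair, and the next elements of \<open>M\<close> then contradict
  closure.\<close>

lemma almost_difference_closed:
  fixes M :: "nat set"
  assumes fin: "finite M" and zero: "0 \<in> M" and c5: "5 \<le> card M"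
    and cl: "\<And>a b. a \<in> M \<Longrightarrow> b \<in> M \<Longrightarrow> a < b \<Longrightarrow> (a, b) \<noteq> (y, z) \<Longrightarrow> b - a \<in> M"
  shows "(\<exists>p\<ge>2. \<forall>m\<in>M. p dvd m) \<or> (\<exists>t \<ge> card M - 1. M \<subseteq> insert t {..<card M - 1})"
proof -
  have next_elem: "\<exists>f\<in>M - A. \<forall>m\<in>M. m < f \<longrightarrow> m \<in> A" if "finite A" "card A < card M" for A
  proof -
    have "M - A \<noteq> {}" using that fin by (metis Diff_eq_empty_iff card_mono not_le)
    then have "Min (M - A) \<in> M - A" using fin by (intro Min_in) auto
    moreover have "m \<in> A" if "m \<in> M" "m < Min (M - A)" for m
      using that fin by (metis DiffI Min_le finite_Diff not_le)
    ultimately show ?thesis by blast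
  qed
  obtain p where p: "p \<in> M" "p \<noteq> 0" and pmin: "\<And>m. m \<in> M \<Longrightarrow> m < p \<Longrightarrow> m = 0"
    using next_elem[of "{0}"] c5 by auto
  have dvd: "p dvd m" if "m \<in> M" for m
  proof (rule ccontr)
    assume "\<not> p dvd m"
    define e where "e = (LEAST e. e \<in> M \<and> \<not> p dvd e)"
    have e: "e \<in> M" "\<not> p dvd e"
      using LeastI[of "\<lambda>e. e \<in> M \<and> \<not> p dvd e" m] that \<open>\<not> p dvd m\<close> unfolding e_def by auto
    have emin: "p dvd m" if "m \<in> M" "m < e" for m
      using not_less_Least[of m "\<lambda>e. e \<in> M \<and> \<not> p dvd e"] that unfolding e_def by auto
    have pe: "p < e" using e pmin[of e] by (metis dvd_0_right dvd_refl linorder_neqE_nat)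
    \<comment> \<open>Otherwise \<open>e - p\<close> would be a smaller element of \<open>M\<close>
      not divisible by \<open>p\<close>.\<close>
    have yz: "(p, e) = (y, z)"
    proof (rule ccontr)
      assume "(p, e) \<noteq> (y, z)"
      then have "p dvd e - p" using cl[OF p(1) e(1) pe] p pe by (intro emin) auto
      then show False using e(2) pe by (metis dvd_diffD1 dvd_refl dvd_diffD less_imp_le)
    qed
    have low: "m \<in> {0, p, e}" if "m \<in> M" "m \<le> e" for m
    proof (rule ccontr)
      assume n: "m \<notin> {0, p, e}"
      then have "m < e" using that by auto
      moreover have "e - m \<in> M" using cl[OF that(1) e(1) \<open>m < e\<close>] n yz by auto
      ultimately have "p dvd e - m" "p dvd m" using n emin that by auto
      then show False using e(2) \<open>m < e\<close> by (metis dvd_diffD less_imp_le)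
    qed
    have "card {0, p, e} < card M" using c5 p pe by simp
    then obtain f where f: "f \<in> M" "f \<notin> {0, p, e}" "\<And>m. m \<in> M \<Longrightarrow> m < f \<Longrightarrow> m \<in> {0, p, e}"
      using next_elem[of "{0, p, e}"] by (metis DiffE finite.emptyI finite.insertI)
    have ef: "e < f" using f low by (meson not_le)
    have "card {0, p, e, f} < card M" using c5 p pe ef by simp
    then obtain g where g: "g \<in> M" "g \<notin> {0, p, e, f}"
      "\<And>m. m \<in> M \<Longrightarrow> m < g \<Longrightarrow> m \<in> {0, p, e, f}"
      using next_elem[of "{0, p, e, f}"] by (metis DiffE finite.emptyI finite.insertI)
    have fg: "f < g"
    proof (rule ccontr)
      assume "\<not> f < g"
      then have "g < f" using g(2) by auto
      then show False using f(3)[OF g(1)] g(2) by auto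
    qed
    have "f - p \<in> M" "f - e \<in> M"
      using cl[of p f] cl[of e f] f p e ef pe yz by auto
    then have fd: "f - p \<in> {0, p, e}" "f - e \<in> {0, p, e}"
      using f(3)[of "f - p"] f(3)[of "f - e"] p ef pe by simp_all
    have "g - p \<in> M" "g - e \<in> M" "g - f \<in> M"
      using cl[of p g] cl[of e g] cl[of f g] f g p e ef pe fg yz by auto
    then have gd: "g - p \<in> {0, p, e, f}" "g - e \<in> {0, p, e, f}" "g - f \<in> {0, p, e, f}"
      using g(3)[of "g - p"] g(3)[of "g - e"] g(3)[of "g - f"] p ef pe fg by simp_all
    \<comment> \<open>The positive differences \<open>f - e < f - p\<close> can only be
      \<open>p\<close> and \<open>e\<close>; likewise those of \<open>g\<close> are
      \<open>p\<close>, \<open>e\<close>, \<open>f\<close>. Both together give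
      \<open>e = 2 * p\<close>.\<close>
    have "f - p = p \<or> f - p = e" "f - e = p \<or> f - e = e" using fd ef pe by auto
    then have fe: "f = e + p" using pe ef p by linarith
    have "g - f \<noteq> 0" "g - f < g - e" "g - e < g - p" using fg ef pe by linarith+
    then have "g - f = p" "g - e = e" using gd ef pe fe by auto
    then have "e = 2 * p" using fe fg by linarith
    then show False using e by simp
  qed
  show ?thesis
  proof (cases "p = 1")
    case False
    then have "2 \<le> p" using p by linarith
    then show ?thesis using dvd by blast
  next
    case True
    show ?thesis
    proof (rule ccontr)
      assume "\<not> ?thesis"
      then have "\<not> (\<exists>t \<ge> card M - 1. M \<subseteq> insert t {..<card M - 1})" by blast
      then obtain q f g where q: "{..<q} \<subseteq> M" "q \<notin> M"
        and f: "f \<in> M" and g: "g \<in> M" and f': "q < f" and g': "f < g"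
        and low: "\<And>m. m \<in> M \<Longrightarrow> m < g \<Longrightarrow> m < q \<or> m = f"
        using two_above_gap[OF fin] by blast
      note f = f f' and g = g g'
      have one: "1 \<in> M" using p True by simp
      have "q \<noteq> 0" "q \<noteq> 1" using q one zero by metis+
      then have q2: "2 \<le> q" by linarith
      have "f - 1 \<notin> M"
      proof
        assume "f - 1 \<in> M"
        then have "f - 1 \<noteq> q" "f - 1 < q \<or> f - 1 = f" using low[of "f - 1"] f g q by auto
        then show False using f by linarith
      qed
      \<comment> \<open>As \<open>f - 1\<close> falls in the gap, \<open>(1, f)\<close> is the
        exceptional pair, and every other positive difference lies in \<open>M\<close>.\<close>
      then have yz: "(1, f) = (y, z)" using cl[OF one f(1)] f q2 by auto
      have g1: "g = f + 1"
        using low[of "g - 1"] cl[OF one g(1)] g f q2 yz by auto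
      show False
      proof (cases "q = 2")
        case False
        then have two: "2 \<in> M" using q q2 by auto
        have "f - 2 \<in> M" "g - 2 \<in> M" using cl[OF two f(1)] cl[OF two g(1)] f g q2 yz by auto
        then have "f - 2 < q \<or> f - 2 = f" using low[of "f - 2"] f g by auto
        then have "f = q + 1" using f q2 by linarith
        then show False using \<open>g - 2 \<in> M\<close> g1 q by simp
      next
        \<comment> \<open>Now \<open>M\<close> begins with \<open>0, 1, f, f + 1\<close>; the next
          element has to be \<open>f + 2\<close>, and its difference to \<open>f\<close> is the
          missing 2.\<close>
        case True
        have "card {0, 1, f, g} < card M" using c5 f g True by simp
        then obtain h where h: "h \<in> M" "h \<notin> {0, 1, f, g}"
          "\<And>m. m \<in> M \<Longrightarrow> m < h \<Longrightarrow> m \<in> {0, 1, f, g}"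
          using next_elem[of "{0, 1, f, g}"] by (metis DiffE finite.emptyI finite.insertI)
        have "g < h"
        proof (rule ccontr)
          assume "\<not> g < h"
          then have "h < g" using h by auto
          then show False using low[OF h(1)] h(2) True by auto
        qed
        moreover have "h - 1 \<in> M" using cl[OF one h(1)] calculation g f yz by auto
        ultimately have "h = f + 2" using h(3)[of "h - 1"] g1 f by auto
        then have "2 \<in> M" using cl[OF f(1) h(1)] yz f True by auto
        then show False using True q by simp
      qed
    qed
  qed
qed

text \<open>Subtracting 1, 2 or 3, when they lie in \<open>S\<close>, makes the elements above the
  first gap \<open>q\<close> fall into the gap. What survives is \<open>x = 1\<close>,
  \<open>q = 3\<close>, where \<open>S\<close> has only even elements, contrary to \<open>s\<close>
  and \<open>Suc s\<close>.\<close>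

lemma initial_segment_of_differences:
  fixes S :: "nat set"
  assumes fin: "finite S" and x: "x \<notin> S" and zero: "0 \<in> S"
    and cl: "\<And>a b. a \<in> S \<Longrightarrow> b \<in> S \<Longrightarrow> a < b \<Longrightarrow> b - a \<in> insert x S"
    and s: "s \<in> S" "Suc s \<in> S" and two: "2 \<in> insert x S"
  shows "\<exists>t \<ge> card S. insert x S \<subseteq> insert t {..<card S}"
proof (rule ccontr)
  let ?M = "insert x S"
  have one: "1 \<in> ?M" using cl[OF s] by simp
  assume "\<not> ?thesis"
  then have "\<not> (\<exists>t \<ge> card ?M - 1. ?M \<subseteq> insert t {..<card ?M - 1})" using fin x by simp
  moreover have "finite ?M" using fin by simp
  ultimately obtain q u v where q: "{..<q} \<subseteq> ?M" "q \<notin> ?M"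
    and u: "u \<in> ?M" and v: "v \<in> ?M" and u': "q < u" and v': "u < v"
    and low: "\<And>m. m \<in> ?M \<Longrightarrow> m < v \<Longrightarrow> m < q \<or> m = u"
    using two_above_gap[of ?M] by blast
  note u = u u' and v = v v'
  have "q \<noteq> 0" "q \<noteq> 1" "q \<noteq> 2" using q(2) zero one two by (intro notI; simp)+
  then have q3: "3 \<le> q" by linarith
  show False
  proof (cases "u \<in> S")
    case True
    have "1 \<notin> S"
    proof
      assume "1 \<in> S"
      then have "u - 1 \<in> ?M" using cl[of 1 u] True u q3 by auto
      then have "u - 1 \<noteq> q" "u - 1 < q \<or> u - 1 = u" using low[of "u - 1"] u v q by auto
      then show False using u by linarith
    qed
    then have x1: "x = 1" and S2: "2 \<in> S" using one two by auto
    have "u - 2 \<in> ?M" using cl[of 2 u] True u q3 S2 by auto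
    then have "u - 2 < q \<or> u - 2 = u" using low[of "u - 2"] u v by auto
    then have uq: "u = q + 1" using u q3 by linarith
    have vS: "v \<in> S" using v x1 u q3 by auto
    then have "v - 2 \<in> ?M" using cl[of 2 v] u v q3 S2 by auto
    then have "v - 2 \<noteq> q" "v - 2 < q \<or> v - 2 = u" using low[of "v - 2"] v u q3 q by auto
    then have vq: "v = q + 3" using uq v q3 by linarith
    have "q = 3"
    proof (rule ccontr)
      assume "q \<noteq> 3"
      then have "3 < q" using q3 by simp
      then have "3 \<in> S" using q(1) x1 by auto
      then have "v - 3 \<in> ?M" using cl[of 3 v] vS vq q3 by auto
      then show False using vq q by auto
    qed
    \<comment> \<open>Subtracting 2 repeatedly from an odd element would lead down to 1 or 3,
      neither of which lies in \<open>S\<close>.\<close>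
    have ev: "even m" if "m \<in> S" for m
      using that
    proof (induction m rule: less_induct)
      case (less m)
      show ?case
      proof (rule ccontr)
        assume "odd m"
        moreover have "m \<noteq> 1" "m \<noteq> 3" using less.prems \<open>1 \<notin> S\<close> q \<open>q = 3\<close> by auto
        ultimately have "3 < m" "odd (m - 2)" by presburger+
        then show False using less.IH[of "m - 2"] cl[OF S2 less.prems] x1 by auto
      qed
    qed
    show False using ev[OF s(1)] ev[OF s(2)] by simp
  next
    case False
    then have "x = u" using u by auto
    then have "1 \<in> S" "2 \<in> S" "v \<in> S" using one two v u q3 by auto
    then have "v - 1 \<in> ?M" "v - 2 \<in> ?M" using cl[of 1 v] cl[of 2 v] u v q3 by auto
    moreover from this have "v - 1 \<noteq> q" "v - 2 \<noteq> q" using q by auto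
    ultimately have "v - 1 < q \<or> v - 1 = u" "v - 2 < q \<or> v - 2 = u"
      using low[of "v - 1"] low[of "v - 2"] v u q3 by auto
    then show False using \<open>v - 2 \<noteq> q\<close> v u q3 by linarith
  qed
qed

text \<open>Lowering the least odd element of \<open>S\<close> by 2 and by 4 must fail. The single
  number \<open>x\<close> can block only one of the two, by being either the subtrahend or the
  difference.\<close>

lemma at_most_one_odd:
  fixes S :: "nat set"
  assumes x: "x \<notin> S" and zero: "0 \<in> S"
    and cl: "\<And>a b. a \<in> S \<Longrightarrow> b \<in> S \<Longrightarrow> a < b \<Longrightarrow> b - a \<in> insert x S"
    and nc: "\<And>s. s \<in> S \<Longrightarrow> Suc s \<notin> S" and two: "2 \<in> insert x S" and four: "4 \<in> insert x S"
    and m: "m \<in> insert x S" "odd m"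
  shows "m = x"
proof -
  have "even m" if "m \<in> S" for m
    using that
  proof (induction m rule: less_induct)
    case (less m)
    show ?case
    proof (rule ccontr)
      assume "odd m"
      have "m \<noteq> 1" using nc[OF zero] less.prems by auto
      then have m3: "3 \<le> m" using \<open>odd m\<close> by presburger
      have four_odd: False if "4 \<in> S" "x \<noteq> m - 4"
      proof -
        have "m \<noteq> 3" using nc[of 3] less.prems that by auto
        then have "4 < m" "odd (m - 4)" using m3 \<open>odd m\<close> by presburger+
        then show False using less.IH[of "m - 4"] cl[OF \<open>4 \<in> S\<close> less.prems] that by auto
      qed
      show False
      proof (cases "2 \<in> S")
        case True
        have "odd (m - 2)" using \<open>odd m\<close> m3 by presburger
        then have xm: "x = m - 2"
          using less.IH[of "m - 2"] cl[OF True less.prems] m3 by auto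
        then have "x \<noteq> 4" using \<open>odd (m - 2)\<close> unfolding xm[symmetric] by auto
        then have "4 \<in> S" using four by simp
        moreover have "m - 2 \<noteq> m - 4" using m3 by arith
        ultimately show False using four_odd xm by auto
      next
        case False
        then have "x = 2" "4 \<in> S" using two four by auto
        moreover have "m - 4 \<noteq> 2" using \<open>odd m\<close> by presburger
        ultimately show False using four_odd by auto
      qed
    qed
  qed
  then show ?thesis using m by auto
qed

section \<open>Colourings from depth-first heights\<close>

definition colourable :: "('a \<Rightarrow> 'a \<Rightarrow> bool) \<Rightarrow> 'a set \<Rightarrow> nat \<Rightarrow> bool" where
  "colourable E U k \<longleftrightarrow> (\<exists>c :: 'a \<Rightarrow> nat. (\<forall>v\<in>U. c v < k) \<and> (\<forall>u\<in>U. \<forall>v\<in>U. E u v \<longrightarrow> c u \<noteq> c v))"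

definition is_cycle :: "('a \<Rightarrow> 'a \<Rightarrow> bool) \<Rightarrow> 'a list \<Rightarrow> bool" where
  "is_cycle E p \<longleftrightarrow> 3 \<le> length p \<and> distinct p \<and> successively E p \<and> E (last p) (hd p)"

definition reachable_in :: "('a \<Rightarrow> 'a \<Rightarrow> bool) \<Rightarrow> 'a set \<Rightarrow> 'a \<Rightarrow> 'a \<Rightarrow> bool" where
  "reachable_in E U = (\<lambda>a b. a \<in> U \<and> b \<in> U \<and> E a b)\<^sup>*\<^sup>*"

definition path_of_length :: "('a \<Rightarrow> 'a \<Rightarrow> bool) \<Rightarrow> 'a set \<Rightarrow> 'a \<Rightarrow> 'a \<Rightarrow> nat \<Rightarrow> bool" where
  "path_of_length E U u v k \<longleftrightarrow> (\<exists>p. p \<noteq> [] \<and> distinct p \<and> set p \<subseteq> U \<and> successively E p \<and>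
     hd p = u \<and> last p = v \<and> length p = Suc k)"

section \<open>Gluing of colourings\<close>

lemma colourable_mono:
  assumes "colourable E U j" "j \<le> k"
  shows "colourable E U k"
proof -
  obtain c :: "'a \<Rightarrow> nat" where "\<forall>v\<in>U. c v < j" "\<forall>u\<in>U. \<forall>v\<in>U. E u v \<longrightarrow> c u \<noteq> c v"
    using assms(1) unfolding colourable_def by blast
  moreover from this(1) have "\<forall>v\<in>U. c v < k" using assms(2) by auto
  ultimately show ?thesis unfolding colourable_def by blast
qed

text \<open>Swapping two colours on \<open>B\<close> makes both colourings agree at
  \<open>z\<close>, the only possible common vertex.\<close>

lemma colourable_glue:
  assumes sym: "symp E" and A: "colourable E A k" and B: "colourable E B k"
    and AB: "A \<inter> B \<subseteq> {z}"
    and no: "\<And>a b. a \<in> A - B \<Longrightarrow> b \<in> B - A \<Longrightarrow> \<not> E a b"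
  shows "colourable E (A \<union> B) k"
proof -
  obtain a :: "'a \<Rightarrow> nat" where a: "\<forall>v\<in>A. a v < k" "\<forall>u\<in>A. \<forall>v\<in>A. E u v \<longrightarrow> a u \<noteq> a v"
    using A unfolding colourable_def by blast
  obtain b :: "'a \<Rightarrow> nat" where b: "\<forall>v\<in>B. b v < k" "\<forall>u\<in>B. \<forall>v\<in>B. E u v \<longrightarrow> b u \<noteq> b v"
    using B unfolding colourable_def by blast
  define s where "s n = (if A \<inter> B = {} then n else
    if n = b z then a z else if n = a z then b z else n)" for n
  define c where "c = s \<circ> b"
  have s_inj: "m = n" if "s m = s n" for m n
    using that unfolding s_def by (simp split: if_splits)
  have "s n < k" if "n < k" for n
    using that a(1) b(1) AB unfolding s_def by auto
  then have c1: "c v < k" if "v \<in> B" for v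
    using that b(1) unfolding c_def by simp
  have c2: "c u \<noteq> c v" if "u \<in> B" "v \<in> B" "E u v" for u v
    using b(2) that s_inj[of "b u" "b v"] unfolding c_def by auto
  have cz: "c z = a z" if "z \<in> A" "z \<in> B"
    using that by (auto simp: c_def s_def)
  have "(\<forall>v\<in>A \<union> B. (if v \<in> A then a v else c v) < k) \<and>
    (\<forall>u\<in>A \<union> B. \<forall>v\<in>A \<union> B. E u v \<longrightarrow>
       (if u \<in> A then a u else c u) \<noteq> (if v \<in> A then a v else c v))"
  proof (intro conjI ballI impI)
    fix u v assume uv: "u \<in> A \<union> B" "v \<in> A \<union> B" "E u v"
    have vu: "E v u" using sym uv(3) by (auto dest: sympD)
    have Bz: "c w = a w" if "w \<in> A" "w \<in> B" for w
      using that AB cz by blast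
    show "(if u \<in> A then a u else c u) \<noteq> (if v \<in> A then a v else c v)"
    proof (cases "u \<in> A \<longleftrightarrow> v \<in> A")
      case True
      show ?thesis
      proof (cases "u \<in> A")
        case uA: True
        then show ?thesis using True a(2) uv(3) by simp
      next
        case uA: False
        then have "u \<in> B" "v \<in> B" using True uv by blast+
        then show ?thesis using True uA c2[OF _ _ uv(3)] by simp
      qed
    next
      case False
      then have "u \<in> B" "v \<in> B" using no[of u v] no[of v u] uv vu by auto
      then have "(if u \<in> A then a u else c u) = c u" "(if v \<in> A then a v else c v) = c v"
        using Bz by simp_all
      then show ?thesis using c2[OF \<open>u \<in> B\<close> \<open>v \<in> B\<close> uv(3)] by simp
    qed
  qed (use a c1 in auto)
  then show ?thesis unfolding colourable_def by (intro exI)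
qed

section \<open>Reachability and depth-first heights\<close>

lemma reachable_in_sym:
  assumes "symp E" "reachable_in E U u v"
  shows "reachable_in E U v u"
  using assms(2) unfolding reachable_in_def
proof (induction rule: rtranclp_induct)
  case (step v w)
  then have "w \<in> U \<and> v \<in> U \<and> E w v" using assms(1) by (auto dest: sympD)
  then show ?case using step.IH by (rule converse_rtranclp_into_rtranclp)
qed simp

text \<open>After its last visit to \<open>r\<close> a walk stays in \<open>U - {r}\<close>.\<close>

lemma reachable_in_first_step:
  assumes "reachable_in E U r u"
  shows "u = r \<or> (\<exists>w \<in> U - {r}. E r w \<and> reachable_in E (U - {r}) w u)"
  using assms unfolding reachable_in_def
proof (induction rule: rtranclp_induct)
  case (step u v)
  show ?case
  proof (cases "v = r \<or> u = r")
    case True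
    then show ?thesis using step by auto
  next
    case False
    then obtain w where w: "w \<in> U - {r}" "E r w"
      "(\<lambda>a b. a \<in> U - {r} \<and> b \<in> U - {r} \<and> E a b)\<^sup>*\<^sup>* w u"
      using step by blast
    moreover have "(\<lambda>a b. a \<in> U - {r} \<and> b \<in> U - {r} \<and> E a b)\<^sup>*\<^sup>* w v"
      using w(3) step.hyps False by (intro rtranclp.rtrancl_into_rtrancl[OF w(3)]) auto
    ultimately show ?thesis by blast
  qed
qed simp

lemma reachable_in_component:
  assumes "reachable_in E U u v" "u \<in> U"
  shows "reachable_in E {w \<in> U. reachable_in E U u w} u v \<and> v \<in> U"
  using assms(1) unfolding reachable_in_def
proof (induction rule: rtranclp_induct)
  case base
  then show ?case using assms by simp
next
  case (step v w)
  let ?C = "{w \<in> U. (\<lambda>a b. a \<in> U \<and> b \<in> U \<and> E a b)\<^sup>*\<^sup>* u w}"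
  have "v \<in> ?C" "w \<in> ?C" using step by (auto intro: rtranclp.rtrancl_into_rtrancl)
  then show ?case using step by (auto intro: rtranclp.rtrancl_into_rtrancl)
qed

lemma path_of_length_mono: "path_of_length E U u v k \<Longrightarrow> U \<subseteq> V \<Longrightarrow> path_of_length E V u v k"
  unfolding path_of_length_def by blast

text \<open>\<open>h\<close> is the height in a depth-first search tree with root \<open>r\<close>: adjacent vertices are ancestor and
  descendant there.\<close>

lemma depth_first_heights_rooted:
  assumes "finite U" "symp E" "\<And>u. \<not> E u u" "r \<in> U" "\<And>u. u \<in> U \<Longrightarrow> reachable_in E U r u"
  shows "\<exists>h. (\<forall>u\<in>U. path_of_length E U r u (h u)) \<and>
    (\<forall>u\<in>U. \<forall>v\<in>U. E u v \<longrightarrow> h u \<le> h v \<longrightarrow> path_of_length E U u v (h v - h u))"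
  using assms(1,4,5)
proof (induction U arbitrary: r rule: finite_psubset_induct)
  case (psubset U)
  let ?W = "U - {r}"
  \<comment> \<open>\<open>C u\<close> is the component of \<open>u\<close> in
    \<open>U - {r}\<close>; the induction hypothesis is applied to it with a neighbour of
    \<open>r\<close> as root.\<close>
  define C where "C u = {v \<in> ?W. reachable_in E ?W u v}" for u
  let ?ok = "\<lambda>K h. (\<forall>u\<in>K. path_of_length E (insert r K) r u (Suc (h u))) \<and>
    (\<forall>u\<in>K. \<forall>v\<in>K. E u v \<longrightarrow> h u \<le> h v \<longrightarrow> path_of_length E K u v (h v - h u))"
  have Csub: "C u \<subseteq> ?W" for u by (auto simp: C_def)
  have trans: "reachable_in E ?W u w" if "reachable_in E ?W u v" "reachable_in E ?W v w" for u v w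
    using that unfolding reachable_in_def by simp
  have Ceq: "C u = C v" if "reachable_in E ?W u v" for u v
    using that trans reachable_in_sym[OF assms(2)] unfolding C_def by blast
  have "\<exists>h. ?ok (C u) h" if "u \<in> ?W" for u
  proof -
    have "u \<in> U" "u \<noteq> r" using that by auto
    then obtain w where w: "w \<in> ?W" "E r w" "reachable_in E ?W w u"
      using reachable_in_first_step[OF psubset.prems(2)[OF \<open>u \<in> U\<close>]] by blast
    have "w \<in> C w" using w by (simp add: C_def reachable_in_def)
    moreover have "C w \<subset> U" using Csub psubset.prems(1) by blast
    moreover have "reachable_in E (C w) w v" if "v \<in> C w" for v
      using that reachable_in_component[of E ?W w v] w(1) unfolding C_def by blast
    ultimately obtain h where h: "\<forall>u\<in>C w. path_of_length E (C w) w u (h u)"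
      "\<forall>u\<in>C w. \<forall>v\<in>C w. E u v \<longrightarrow> h u \<le> h v \<longrightarrow> path_of_length E (C w) u v (h v - h u)"
      using psubset.IH[of "C w" w] by blast
    have "path_of_length E (insert r (C w)) r v (Suc (h v))" if v: "v \<in> C w" for v
    proof -
      obtain p where "p \<noteq> []" "distinct p" "set p \<subseteq> C w" "successively E p" "hd p = w"
        "last p = v" "length p = Suc (h v)"
        using h(1) v unfolding path_of_length_def by blast
      then show ?thesis using w(2) Csub[of w] unfolding path_of_length_def
        by (intro exI[of _ "r # p"]) (cases p; auto)
    qed
    then show ?thesis using h Ceq[OF w(3)] by metis
  qed
  then have "\<forall>K \<in> C ` ?W. \<exists>h. ?ok K h" by blast
  then obtain H where H: "\<forall>K \<in> C ` ?W. ?ok K (H K)" by (rule bchoice[THEN exE])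
  \<comment> \<open>Hanging the trees of the components below \<open>r\<close> raises their heights
    by one.\<close>
  define h where "h u = (if u = r then 0 else Suc (H (C u) u))" for u
  have self: "u \<in> C u" if "u \<in> ?W" for u using that by (simp add: C_def reachable_in_def)
  have root: "path_of_length E U r u (h u)" if "u \<in> U" for u
  proof (cases "u = r")
    case True
    then show ?thesis using that by (auto simp: h_def path_of_length_def intro!: exI[of _ "[r]"])
  next
    case False
    then have u: "u \<in> ?W" using that by simp
    then have "path_of_length E (insert r (C u)) r u (Suc (H (C u) u))" using H self by blast
    then show ?thesis using False Csub[of u] psubset.prems(1)
      by (auto simp: h_def elim: path_of_length_mono)
  qed
  have "path_of_length E U u v (h v - h u)" if "u \<in> U" "v \<in> U" "E u v" "h u \<le> h v" for u v
  proof (cases "u = r")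
    case True
    then show ?thesis using root[OF that(2)] by (simp add: h_def)
  next
    case False
    then have W: "u \<in> ?W" "v \<in> ?W" using that by (auto simp: h_def split: if_splits)
    then have "reachable_in E ?W u v" using that unfolding reachable_in_def by auto
    then have "C u = C v" "v \<in> C u" using Ceq W by (auto simp: C_def)
    then have "path_of_length E (C u) u v (H (C u) v - H (C u) u)"
      using H W self[of u] that False by (auto simp: h_def split: if_splits)
    then show ?thesis using W \<open>C u = C v\<close> Csub[of u]
      by (auto simp: h_def elim: path_of_length_mono)
  qed
  then show ?case using root by blast
qed

text \<open>Otherwise the vertices reachable from \<open>r\<close> and the remaining ones are proper
  subsets with no edges between them, and their colourings combine.\<close>

lemma connected_if_vertex_critical:
  assumes "symp E" "\<not> colourable E U k" "\<And>W. W \<subset> U \<Longrightarrow> colourable E W k" "r \<in> U" "u \<in> U"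
  shows "reachable_in E U r u"
proof (rule ccontr)
  assume no: "\<not> reachable_in E U r u"
  define A where "A = {v \<in> U. reachable_in E U r v}"
  have "r \<in> A" using assms(4) by (simp add: A_def reachable_in_def)
  then have "A \<subset> U" "U - A \<subset> U" using no assms by (auto simp: A_def)
  moreover have "\<not> E a b" if "a \<in> A" "b \<in> U - A" for a b
    using that unfolding A_def reachable_in_def by (auto dest: rtranclp.rtrancl_into_rtrancl)
  ultimately have "colourable E (A \<union> (U - A)) k"
    using assms(1,3) by (intro colourable_glue[where z = r]) auto
  moreover have "A \<union> (U - A) = U" by (auto simp: A_def)
  ultimately show False using assms(2) by simp
qed

text \<open>The tree path between adjacent vertices closes to a cycle with
  \<open>h v - h u + 1\<close> vertices, unless it is a single edge, which is the case
  \<open>m = 0\<close>.\<close>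

lemma depth_first_heights:
  assumes "finite U" "symp E" "\<And>u. \<not> E u u" "\<not> colourable E U k" "\<And>W. W \<subset> U \<Longrightarrow> colourable E W k"
    and zero: "0 \<in> M" and cyc: "\<And>p. is_cycle E p \<Longrightarrow> set p \<subseteq> U \<Longrightarrow> length p - 2 \<in> M"
  obtains h :: "'a \<Rightarrow> nat" where "\<And>u v. u \<in> U \<Longrightarrow> v \<in> U \<Longrightarrow> E u v \<Longrightarrow> h u \<le> h v \<Longrightarrow> \<exists>m\<in>M. h v = h u + Suc m"
proof -
  have "U \<noteq> {}" using assms(4) by (auto simp: colourable_def)
  then obtain r where "r \<in> U" by blast
  then obtain h where h: "\<forall>u\<in>U. \<forall>v\<in>U. E u v \<longrightarrow> h u \<le> h v \<longrightarrow> path_of_length E U u v (h v - h u)"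
    using depth_first_heights_rooted[OF assms(1-3), of r]
      connected_if_vertex_critical[OF assms(2,4,5)] by blast
  have "\<exists>m\<in>M. h v = h u + Suc m" if uv: "u \<in> U" "v \<in> U" "E u v" "h u \<le> h v" for u v
  proof -
    obtain p where p: "p \<noteq> []" "distinct p" "set p \<subseteq> U" "successively E p" "hd p = u" "last p = v"
      "length p = Suc (h v - h u)"
      using h uv unfolding path_of_length_def by blast
    have vu: "E v u" using assms(2) uv(3) by (auto dest: sympD)
    show ?thesis
    proof (cases "3 \<le> length p")
      case True
      then have "is_cycle E p" using p vu by (simp add: is_cycle_def)
      then have "length p - 2 \<in> M" using cyc p by blast
      then show ?thesis using p True uv(4) by (intro bexI[of _ "length p - 2"]) auto
    next
      case False
      have "h v \<noteq> h u"
      proof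
        assume "h v = h u"
        then have "u = v" using p by (cases p) auto
        then show False using assms(3) uv(3) by blast
      qed
      then have "h v = h u + Suc 0" using False p uv(4) by linarith
      then show ?thesis using zero by blast
    qed
  qed
  then show ?thesis using that by blast
qed

lemma colourable_of_heights:
  assumes sym: "symp E" and c: "\<And>a m. m \<in> M \<Longrightarrow> c (a + Suc m) \<noteq> c (a :: nat)" and k: "\<And>a. c a < (k :: nat)"
    and h: "\<And>u v. u \<in> U \<Longrightarrow> v \<in> U \<Longrightarrow> E u v \<Longrightarrow> h u \<le> h v \<Longrightarrow> \<exists>m\<in>M. h v = h u + Suc m"
  shows "colourable E U k"
proof -
  have "c (h u) \<noteq> c (h v)" if "u \<in> U" "v \<in> U" "E u v" for u v
  proof (cases "h u \<le> h v")
    case True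
    then show ?thesis using h[OF that] c by metis
  next
    case False
    have "E v u" using sym that(3) by (auto dest: sympD)
    then show ?thesis using h[OF that(2,1)] False c by (metis nat_le_linear)
  qed
  then show ?thesis unfolding colourable_def using k by (intro exI[of _ "c \<circ> h"]) auto
qed

section \<open>Colourings of integer distance graphs\<close>

text \<open>Modulo \<open>p\<close> the distance is 1, so it suffices to colour the cyclic order of
  residues: alternate 0 and 1, and give the last residue colour 2.\<close>

lemma three_colouring_of_congruence:
  assumes "2 \<le> p" "p dvd m"
  shows "(\<lambda>a. if a mod p = p - 1 then 2 else a mod p mod 2) (a + Suc m)
       \<noteq> (\<lambda>a. if a mod p = p - 1 then 2 else a mod p mod 2) (a :: nat)"
proof -
  obtain j where m: "m = p * j" using assms by auto
  define r where "r = a mod p"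
  have "(a + Suc m) mod p = Suc r mod p"
    unfolding r_def m by (metis add_Suc_right mod_Suc_eq mod_mult_self2)
  moreover have "r < p" using assms(1) by (simp add: r_def)
  moreover have "(if Suc r mod p = p - 1 then 2 else Suc r mod p mod 2) \<noteq> (if r = p - 1 then 2 else r mod 2)"
  proof (cases "Suc r = p")
    case True
    then show ?thesis using assms(1) by auto
  next
    case False
    then have "Suc r mod p = Suc r" "r \<noteq> p - 1" using \<open>r < p\<close> by auto
    moreover have "Suc r mod 2 \<noteq> r mod 2" "r mod 2 < 2" by presburger+
    ultimately show ?thesis by auto
  qed
  ultimately show ?thesis by (simp only: r_def[symmetric] not_False_eq_True)
qed

text \<open>For even \<open>m\<close> the distance is odd and changes the parity of
  \<open>a\<close>. The only possible even distance \<open>Suc x\<close> moves \<open>a\<close> to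
  the next block of that length and changes the parity of the block number.\<close>

lemma four_colouring_of_one_even_distance:
  assumes "odd m \<Longrightarrow> m = x"
  shows "(\<lambda>a. 2 * ((a div Suc x) mod 2) + a mod 2) (a + Suc m)
       \<noteq> (\<lambda>a. 2 * ((a div Suc x) mod 2) + a mod 2) (a :: nat)"
proof (cases "odd m")
  case True
  then have "(a + Suc m) div Suc x = Suc (a div Suc x)"
    using assms True div_add_self2[of "Suc x" a] by simp
  moreover have "(a + Suc m) mod 2 = a mod 2" using True by presburger
  moreover have "Suc (a div Suc x) mod 2 \<noteq> a div Suc x mod 2" by (simp add: mod_Suc)
  ultimately show ?thesis by simp
next
  case False
  then have "(a + Suc m) mod 2 \<noteq> a mod 2" by presburger
  moreover have "2 * P + r \<noteq> 2 * Q + s" if "r < 2" "s < 2" "r \<noteq> s" for P Q r s :: nat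
    using that by presburger
  moreover have "(a + Suc m) mod 2 < 2" "a mod 2 < 2" by simp_all
  ultimately show ?thesis by blast
qed

section \<open>Longest paths in vertex-critical graphs\<close>

text \<open>\<open>M\<close> consists of \<open>0\<close> and the numbers \<open>m\<close> such that cycles of length \<open>m + 2\<close> are allowed. With this
  shift the differences of two chords of a longest path at its first vertex lie in \<open>M\<close>.\<close>

locale vertex_critical =
  fixes E :: "'a \<Rightarrow> 'a \<Rightarrow> bool" and U :: "'a set" and d :: nat and M :: "nat set"
  assumes fin: "finite U" and sym: "E u v \<Longrightarrow> E v u" and irrefl: "\<not> E u u"
    and d4: "4 \<le> d"
    and finM: "finite M" and cardM: "card M = Suc d" and zeroM: "0 \<in> M"
    and cyc: "is_cycle E p \<Longrightarrow> set p \<subseteq> U \<Longrightarrow> length p - 2 \<in> M"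
    and not_col: "\<not> colourable E U d"
    and crit: "W \<subset> U \<Longrightarrow> colourable E W d"
begin

text \<open>In a colouring of \<open>U - {v}\<close> fewer than \<open>d\<close> neighbours would
  leave a colour free for \<open>v\<close>.\<close>

lemma degree:
  assumes "v \<in> U"
  shows "d \<le> card {w \<in> U. E v w}"
proof (rule ccontr)
  assume less: "\<not> ?thesis"
  obtain c :: "'a \<Rightarrow> nat" where c: "\<And>u. u \<in> U - {v} \<Longrightarrow> c u < d"
    "\<And>u w. u \<in> U - {v} \<Longrightarrow> w \<in> U - {v} \<Longrightarrow> E u w \<Longrightarrow> c u \<noteq> c w"
    using crit[of "U - {v}"] assms unfolding colourable_def by blast
  let ?N = "{w \<in> U. E v w}"
  have "card (c ` ?N) < card {..<d}" using less card_image_le[of ?N c] fin by simp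
  then have "\<not> {..<d} \<subseteq> c ` ?N" using card_mono[of "c ` ?N" "{..<d}"] fin by auto
  then obtain a where a: "a < d" "a \<notin> c ` ?N" by blast
  have "(c(v := a)) u \<noteq> (c(v := a)) w" if "u \<in> U" "w \<in> U" "E u w" for u w
    using that c(2)[of u w] a irrefl sym[OF that(3)] by (auto simp: image_iff)
  then have "colourable E U d" unfolding colourable_def
    using c(1) a by (intro exI[of _ "c(v := a)"]) auto
  then show False using not_col by simp
qed

section \<open>Longest paths, chords and rotations\<close>

definition is_path :: "(nat \<Rightarrow> 'a) \<Rightarrow> nat \<Rightarrow> bool" where
  "is_path f n \<longleftrightarrow> inj_on f {..n} \<and> f ` {..n} \<subseteq> U \<and> (\<forall>i<n. E (f i) (f (Suc i)))"

definition len :: nat where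
  "len = Max {n. \<exists>f. is_path f n}"

abbreviation longest :: "(nat \<Rightarrow> 'a) \<Rightarrow> bool" where
  "longest f \<equiv> is_path f len"

definition chords :: "(nat \<Rightarrow> 'a) \<Rightarrow> nat set" where
  "chords f = {j. j < len \<and> E (f 0) (f (Suc j))}"

text \<open>A chord from \<open>f 0\<close> to \<open>f (j + 1)\<close> turns \<open>f\<close> into the path
  \<open>f j, \<dots>, f 0, f (j + 1), f (j + 2), \<dots>\<close>.\<close>

definition rot :: "nat \<Rightarrow> (nat \<Rightarrow> 'a) \<Rightarrow> nat \<Rightarrow> 'a" where
  "rot j f = (\<lambda>i. if i \<le> j then f (j - i) else f i)"

lemma is_path_length: "is_path f n \<Longrightarrow> n < card U"
  unfolding is_path_def using card_image[of f "{..n}"] card_mono[OF fin, of "f ` {..n}"] by auto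

lemma U_nonempty: "U \<noteq> {}"
  using not_col by (auto simp: colourable_def)

lemma longest_exists: "\<exists>f. longest f" and is_path_le_len: "is_path f n \<Longrightarrow> n \<le> len"
proof -
  have "{n. \<exists>f. is_path f n} \<subseteq> {..card U}" using is_path_length by fastforce
  then have finP: "finite {n. \<exists>f. is_path f n}" using finite_subset by blast
  obtain u where "u \<in> U" using U_nonempty by blast
  then have "is_path (\<lambda>_. u) 0" by (simp add: is_path_def)
  then have "{n. \<exists>f. is_path f n} \<noteq> {}" by blast
  then show "\<exists>f. longest f" using Max_in[OF finP] unfolding len_def by blast
  show "is_path f n \<Longrightarrow> n \<le> len" using finP unfolding len_def by (intro Max_ge) auto
qed

lemma longest_in: "longest f \<Longrightarrow> i \<le> len \<Longrightarrow> f i \<in> U"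
  unfolding is_path_def by auto

lemma longest_inj: "longest f \<Longrightarrow> i \<le> len \<Longrightarrow> j \<le> len \<Longrightarrow> f i = f j \<Longrightarrow> i = j"
  unfolding is_path_def by (auto dest: inj_onD)

lemma longest_edge: "longest f \<Longrightarrow> i < len \<Longrightarrow> E (f i) (f (Suc i))"
  unfolding is_path_def by auto

text \<open>Otherwise \<open>w\<close> could be put in front of the path.\<close>

lemma neighbour_on_longest:
  assumes f: "longest f" and w: "w \<in> U" "E (f 0) w"
  shows "\<exists>j \<in> chords f. w = f (Suc j)"
proof -
  have "w \<in> f ` {..len}"
  proof (rule ccontr)
    assume no: "w \<notin> f ` {..len}"
    let ?g = "\<lambda>i. if i = 0 then w else f (i - 1)"
    have "inj_on ?g {..Suc len}"
    proof (rule inj_onI)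
      fix i j assume ij: "i \<in> {..Suc len}" "j \<in> {..Suc len}" "?g i = ?g j"
      show "i = j"
        using ij no longest_inj[OF f, of "i - 1" "j - 1"] by (cases i; cases j) (auto split: if_splits)
    qed
    moreover have "?g ` {..Suc len} \<subseteq> U" using w longest_in[OF f] by auto
    moreover have "E (?g i) (?g (Suc i))" if "i < Suc len" for i
      using that w sym longest_edge[OF f, of "i - 1"] by (cases i) auto
    ultimately have "is_path ?g (Suc len)" by (simp add: is_path_def)
    then show False using is_path_le_len by fastforce
  qed
  then obtain i where i: "i \<le> len" "w = f i" by auto
  then have "i \<noteq> 0" using w irrefl by (metis)
  then show ?thesis using i w by (intro bexI[of _ "i - 1"]) (auto simp: chords_def)
qed

lemma finite_chords: "finite (chords f)"
  by (simp add: chords_def)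

lemma card_chords:
  assumes f: "longest f"
  shows "d \<le> card (chords f)"
proof -
  have "{w \<in> U. E (f 0) w} \<subseteq> (f \<circ> Suc) ` chords f"
    using neighbour_on_longest[OF f] by auto
  then have "card {w \<in> U. E (f 0) w} \<le> card (chords f)"
    using finite_chords by (meson card_image_le card_mono finite_imageI le_trans)
  then show ?thesis using degree[OF longest_in[OF f, of 0]] by simp
qed

lemma zero_chords: "longest f \<Longrightarrow> 0 \<in> chords f"
proof -
  assume f: "longest f"
  have "chords f \<noteq> {}" using card_chords[OF f] d4 by auto
  then show ?thesis using longest_edge[OF f, of 0] by (auto simp: chords_def)
qed

lemma successively_map_path:
  assumes "longest f" "b \<le> Suc len"
  shows "successively E (map f [a..<b])"
  using assms(2)
proof (induction b)
  case (Suc b)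
  show ?case
  proof (cases "a < b")
    case True
    then obtain b' where b: "b = Suc b'" by (cases b) auto
    then show ?thesis using Suc True longest_edge[OF assms(1), of b']
      by (auto simp: successively_append_iff)
  qed (use Suc in \<open>auto simp: le_Suc_eq\<close>)
qed simp

lemma distinct_map_path: "longest f \<Longrightarrow> b \<le> Suc len \<Longrightarrow> distinct (map f [a..<b])"
  by (auto simp: distinct_map inj_on_def intro: longest_inj)

text \<open>The vertices \<open>f 0, f (i + 1), ..., f (j + 1)\<close> form a cycle of length
  \<open>j - i + 2\<close>.\<close>

lemma chords_diff:
  assumes f: "longest f" and ij: "i \<in> chords f" "j \<in> chords f" "i < j"
  shows "j - i \<in> M"
proof -
  let ?p = "f 0 # map f [Suc i..<Suc (Suc j)]"
  have j: "j < len" using ij by (simp add: chords_def)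
  have "f 0 \<notin> set (map f [Suc i..<Suc (Suc j)])"
  proof
    assume "f 0 \<in> set (map f [Suc i..<Suc (Suc j)])"
    then obtain k where "k \<in> {Suc i..<Suc (Suc j)}" "f 0 = f k" by (auto simp del: upt_Suc)
    then show False using longest_inj[OF f, of 0 k] j by simp
  qed
  then have "distinct ?p" using distinct_map_path[OF f, of "Suc (Suc j)"] j by (simp del: upt_Suc)
  moreover have "successively E ?p"
    using successively_map_path[OF f, of "Suc (Suc j)" "Suc i"] j ij
    by (auto simp: successively_Cons chords_def upt_conv_Cons simp del: upt_Suc)
  moreover have "E (last ?p) (hd ?p)" using ij sym by (auto simp: chords_def)
  ultimately have "is_cycle E ?p" using ij by (auto simp: is_cycle_def)
  moreover have "set ?p \<subseteq> U" using longest_in[OF f] j by auto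
  ultimately have "length ?p - 2 \<in> M" by (rule cyc)
  moreover have "length ?p - 2 = j - i" using ij by simp
  ultimately show ?thesis by simp
qed

lemma chords_subset: "longest f \<Longrightarrow> chords f \<subseteq> M"
  using chords_diff[OF _ zero_chords] zeroM by (metis diff_zero neq0_conv subsetI)

text \<open>\<open>M\<close> has \<open>d + 1\<close> elements and there are at least
  \<open>d\<close> chords.\<close>

lemma chords_cases:
  assumes "longest f"
  obtains "chords f = M" | x where "M = insert x (chords f)" "x \<notin> chords f"
proof (cases "chords f = M")
  case False
  then have "M - chords f \<noteq> {}" using chords_subset[OF assms] by blast
  then have "card (M - chords f) \<noteq> 0" using finM by simp
  moreover have "card (M - chords f) = card M - card (chords f)"
    using chords_subset[OF assms] finite_chords by (rule card_Diff_subset[rotated])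
  ultimately have "card (M - chords f) = 1" using cardM card_chords[OF assms] by linarith
  then obtain x where "M - chords f = {x}" by (auto simp: card_1_singleton_iff)
  then show ?thesis using that chords_subset[OF assms] by blast
qed

lemma rot_longest:
  assumes f: "longest f" and j: "j \<in> chords f"
  shows "longest (rot j f)"
proof -
  have jl: "j < len" "E (f 0) (f (Suc j))" using j by (auto simp: chords_def)
  have "inj_on (rot j f) {..len}"
  proof (rule inj_onI)
    fix a b assume ab: "a \<in> {..len}" "b \<in> {..len}" "rot j f a = rot j f b"
    let ?s = "\<lambda>i. if i \<le> j then j - i else i"
    have "f (?s a) = f (?s b)" using ab(3) by (simp add: rot_def split: if_splits)
    then have "?s a = ?s b" using longest_inj[OF f, of "?s a" "?s b"] ab jl by auto
    then show "a = b" by (auto split: if_splits)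
  qed
  moreover have "rot j f ` {..len} \<subseteq> U" using longest_in[OF f] jl by (auto simp: rot_def)
  moreover have "E (rot j f i) (rot j f (Suc i))" if "i < len" for i
  proof (cases "i < j")
    case True
    then have "E (f (j - Suc i)) (f (Suc (j - Suc i)))" using longest_edge[OF f] jl by auto
    then show ?thesis using True sym by (simp add: rot_def Suc_diff_Suc)
  next
    case False
    then show ?thesis using that jl longest_edge[OF f, of i] by (auto simp: rot_def le_Suc_eq)
  qed
  ultimately show ?thesis by (simp add: is_path_def)
qed

lemma rot_0 [simp]: "rot j f 0 = f j"
  by (simp add: rot_def)

lemma rot_above [simp]: "j < i \<Longrightarrow> rot j f i = f i"
  by (simp add: rot_def)

lemma rot_edge:
  assumes "j \<in> chords (rot i f)" "i \<le> j"
  shows "E (f i) (f (Suc j))"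
  using assms by (simp add: chords_def)

definition has_clique :: bool where
  "has_clique \<longleftrightarrow> (\<exists>C\<subseteq>U. card C = Suc d \<and> (\<forall>u\<in>C. \<forall>v\<in>C. u \<noteq> v \<longrightarrow> E u v))"

text \<open>Each \<open>f i\<close> with \<open>i < d\<close> is the first vertex of a rotation,
  whose chords join it to all later vertices up to \<open>f d\<close>.\<close>

lemma clique_if_initial_segments:
  assumes "\<And>f. longest f \<Longrightarrow> chords f = {..<d}"
  shows has_clique
proof -
  obtain f where f: "longest f" using longest_exists by blast
  have "d - 1 \<in> chords f" using assms[OF f] d4 by simp
  then have len: "d \<le> len" by (auto simp: chords_def)
  have e: "E (f i) (f j)" if "i < j" "j \<le> d" for i j
  proof -
    have "longest (rot i f)" using rot_longest[OF f] assms[OF f] that by simp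
    then have "j - 1 \<in> chords (rot i f)" using assms that by simp
    then show ?thesis using rot_edge[of "j - 1" i f] that by simp
  qed
  have "card (f ` {..d}) = Suc d" using f len
    by (subst card_image) (auto simp: is_path_def intro: inj_on_subset)
  moreover have "f ` {..d} \<subseteq> U" using longest_in[OF f] len by auto
  moreover have "\<forall>u\<in>f ` {..d}. \<forall>v\<in>f ` {..d}. u \<noteq> v \<longrightarrow> E u v"
    using e sym by (metis (no_types, lifting) atMost_iff image_iff linorder_neqE_nat)
  ultimately show ?thesis unfolding has_clique_def by blast
qed

section \<open>Restricting the shape of \<open>M\<close>\<close>

lemma heights:
  obtains h :: "'a \<Rightarrow> nat" where
    "\<And>u v. u \<in> U \<Longrightarrow> v \<in> U \<Longrightarrow> E u v \<Longrightarrow> h u \<le> h v \<Longrightarrow> \<exists>m\<in>M. h v = h u + Suc m"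
  using depth_first_heights[OF fin _ irrefl not_col crit zeroM cyc] sym by (auto simp: symp_def)

lemma no_height_colouring:
  assumes "\<And>a m. m \<in> M \<Longrightarrow> c (a + Suc m) \<noteq> c (a :: nat)" "\<And>a. c a < (4 :: nat)"
  shows False
proof -
  obtain h :: "'a \<Rightarrow> nat" where
    "\<And>u v. u \<in> U \<Longrightarrow> v \<in> U \<Longrightarrow> E u v \<Longrightarrow> h u \<le> h v \<Longrightarrow> \<exists>m\<in>M. h v = h u + Suc m"
    using heights by blast
  then have "colourable E U 4"
    using colourable_of_heights[of E M c 4 U h] assms sym by (auto simp: symp_def)
  then show False using colourable_mono[OF _ d4] not_col by blast
qed

lemma not_multiples:
  assumes "2 \<le> p" "\<And>m. m \<in> M \<Longrightarrow> p dvd m"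
  shows False
proof -
  let ?c = "\<lambda>a :: nat. if a mod p = p - 1 then 2 else a mod p mod 2"
  have "?c (a + Suc m) \<noteq> ?c a" if "m \<in> M" for a m
    using three_colouring_of_congruence[OF assms(1) assms(2)[OF that]] .
  moreover have "?c a < 4" for a
    using mod_less_divisor[of 2 "a mod p"] by (simp del: mod_less_divisor)
  ultimately show False by (rule no_height_colouring)
qed

lemma not_one_odd:
  assumes "\<And>m. m \<in> M \<Longrightarrow> odd m \<Longrightarrow> m = x"
  shows False
proof -
  let ?c = "\<lambda>a :: nat. 2 * ((a div Suc x) mod 2) + a mod 2"
  have "?c (a + Suc m) \<noteq> ?c a" if "m \<in> M" for a m
    using four_colouring_of_one_even_distance[OF assms[OF that]] .
  moreover have "?c a < 4" for a
    using mod_less_divisor[of 2 "a div Suc x"] mod_less_divisor[of 2 a] by linarith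
  ultimately show False by (rule no_height_colouring)
qed

definition nearly_initial :: bool where
  "nearly_initial \<longleftrightarrow> (\<exists>t\<ge>d. M = insert t {..<d})"

lemma nearly_initialI:
  assumes "t \<ge> d" "M \<subseteq> insert t {..<d}"
  shows nearly_initial
proof -
  have "M = insert t {..<d}"
    using assms cardM by (intro card_subset_eq) auto
  then show ?thesis using assms(1) unfolding nearly_initial_def by blast
qed

lemma nearly_initial_if_closed:
  assumes "\<And>a b. a \<in> M \<Longrightarrow> b \<in> M \<Longrightarrow> a < b \<Longrightarrow> (a, b) \<noteq> (y, z) \<Longrightarrow> b - a \<in> M"
  shows nearly_initial
  using almost_difference_closed[OF finM zeroM _ assms] cardM d4 not_multiples nearly_initialI
  by fastforce

text \<open>Two different chord sets miss different elements \<open>x\<close>, \<open>y\<close> of \<open>M\<close>, so all differences in \<open>M\<close>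
  except possibly that of \<open>x\<close> and \<open>y\<close> lie in \<open>M\<close>.\<close>

lemma nearly_initial_if_different:
  assumes f: "longest f" and g: "longest g" and ne: "chords f \<noteq> chords g"
  shows nearly_initial
proof (cases "chords f = M \<or> chords g = M")
  case True
  \<comment> \<open>A full chord set makes \<open>M\<close> closed under all positive differences;
    \<open>(0, 0)\<close> is a filler for the exceptional pair.\<close>
  then show ?thesis using nearly_initial_if_closed[of 0 0] chords_diff f g by metis
next
  case False
  then obtain x where x: "M = insert x (chords f)" "x \<notin> chords f" using chords_cases[OF f] by metis
  obtain y where y: "M = insert y (chords g)" "y \<notin> chords g" using chords_cases[OF g] False by metis
  show ?thesis
  proof (rule nearly_initial_if_closed)
    fix a b assume ab: "a \<in> M" "b \<in> M" "a < b" "(a, b) \<noteq> (min x y, max x y)"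
    show "b - a \<in> M"
    proof (cases "x \<in> {a, b} \<and> y \<in> {a, b}")
      case True
      then have "x = y" using ab by (auto simp: min_def max_def split: if_splits)
      then have "chords f = chords g" using x y by (metis insert_ident)
      then show ?thesis using ne by simp
    next
      case False
      then have "(a \<in> chords f \<and> b \<in> chords f) \<or> (a \<in> chords g \<and> b \<in> chords g)"
        using x(1) y(1) ab(1,2) by auto
      then show ?thesis using chords_diff[OF f] chords_diff[OF g] ab(3) by metis
    qed
  qed
qed

end

section \<open>Finding a clique\<close>

context vertex_critical begin

text \<open>If all longest paths have the same chord set, then every rotated end vertex \<open>f s\<close> sees
  \<open>f (t + 1)\<close> for all \<open>t \<ge> s\<close> in the chord set, which gives a half graph.\<close>

lemma ladder:
  assumes S: "\<And>f. longest f \<Longrightarrow> chords f = S"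
  shows "2 \<in> M" and "(\<And>s. s \<in> S \<Longrightarrow> Suc s \<notin> S) \<Longrightarrow> 4 \<in> M"
proof -
  obtain f where f: "longest f" using longest_exists by blast
  have finS: "finite S" using finite_chords S[OF f] by metis
  have zS: "0 \<in> S" using zero_chords[OF f] S[OF f] by simp
  obtain a b c where abc: "a \<in> S" "b \<in> S" "c \<in> S" "0 < a" "a < b" "b < c"
  proof -
    have c3: "3 \<le> card (S - {0})" using card_chords[OF f] S[OF f] d4 zS finS by simp
    then obtain T where T: "T \<subseteq> S - {0}" "card T = 3" by (meson obtain_subset_with_card_n)
    then obtain x y z where "T = {x, y, z}" "x \<noteq> y" "y \<noteq> z" "x \<noteq> z" by (auto simp: card_3_iff)
    then show thesis using T(1) that
      by (metis (no_types, opaque_lifting) DiffE insertCI insert_subset linorder_neqE_nat gr0I)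
  qed
  have in_len: "s < len" if "s \<in> S" for s using that S[OF f] by (auto simp: chords_def)
  \<comment> \<open>Rotating at \<open>s\<close> makes \<open>f s\<close> the first vertex of a
    longest path, which again has chord set \<open>S\<close>.\<close>
  have e: "E (f s) (f (Suc t))" if "s \<in> S" "t \<in> S" "s \<le> t" for s t
    using rot_edge[of t s f] rot_longest[OF f, of s] S f that by simp
  have e': "E (f (Suc t)) (f s)" if "s \<in> S" "t \<in> S" "s \<le> t" for s t
    using e[OF that] by (rule sym)
  have inU: "f s \<in> U" "f (Suc s) \<in> U" if "s \<in> S" for s
    using longest_in[OF f] in_len[OF that] by auto
  have ne: "f s \<noteq> f t" if "s \<noteq> t" "s \<le> Suc c" "t \<le> Suc c" for s t
    using longest_inj[OF f, of s t] in_len[OF abc(3)] that by auto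
  \<comment> \<open>Both \<open>f 0\<close> and \<open>f a\<close> see both \<open>f (Suc a)\<close>
    and \<open>f (Suc b)\<close>.\<close>
  let ?p = "[f 0, f (Suc a), f a, f (Suc b)]"
  have "is_cycle E ?p" unfolding is_cycle_def using abc zS by (simp add: e e' ne)
  then have "length ?p - 2 \<in> M" using inU abc zS by (intro cyc) auto
  then show "2 \<in> M" by (simp add: numeral_eq_Suc)
  assume nc: "\<And>s. s \<in> S \<Longrightarrow> Suc s \<notin> S"
  \<comment> \<open>This keeps \<open>f (Suc a)\<close> and \<open>f b\<close> apart in the
    6-cycle.\<close>
  then have n: "Suc a \<noteq> b" "b \<noteq> Suc a" using abc(1,2) by metis+
  let ?q = "[f 0, f (Suc a), f a, f (Suc b), f b, f (Suc c)]"
  have "is_cycle E ?q" unfolding is_cycle_def using abc zS n by (simp add: e e' ne)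
  then have "length ?q - 2 \<in> M" using inU abc zS by (intro cyc) auto
  then show "4 \<in> M" by (simp add: numeral_eq_Suc)
qed

text \<open>Otherwise all longest paths share one chord set \<open>S\<close>, and
  \<open>ladder\<close> puts 2 into \<open>M\<close>. Consecutive elements of \<open>S\<close> then
  force the desired shape; without them 4 lies in \<open>M\<close> as well, and at most one element
  of \<open>M\<close> is odd.\<close>

lemma nearly_initial: nearly_initial
proof (rule ccontr)
  assume no: "\<not> nearly_initial"
  obtain f where f: "longest f" using longest_exists by blast
  define S where "S = chords f"
  have S: "chords g = S" if "longest g" for g
    using nearly_initial_if_different[OF f that] no by (auto simp: S_def)
  have "S \<noteq> M"
    using nearly_initial_if_closed[of 0 0] no chords_diff[OF f] unfolding S_def by blast
  then obtain x where x: "M = insert x S" "x \<notin> S" using chords_cases[OF f] unfolding S_def by blast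
  have finS: "finite S" and zS: "0 \<in> S"
    using finite_chords zero_chords[OF f] unfolding S_def by blast+
  have cardS: "card S = d" using cardM x finS by simp
  have cl: "b - a \<in> insert x S" if "a \<in> S" "b \<in> S" "a < b" for a b
    using chords_diff[OF f] that x(1) unfolding S_def by blast
  have two: "2 \<in> insert x S" using ladder(1)[OF S] x(1) by simp
  show False
  proof (cases "\<exists>s. s \<in> S \<and> Suc s \<in> S")
    case True
    then obtain s where "s \<in> S" "Suc s \<in> S" by blast
    then have "\<exists>t\<ge>card S. insert x S \<subseteq> insert t {..<card S}"
      using initial_segment_of_differences[OF finS x(2) zS cl _ _ two] by blast
    then show False using nearly_initialI no x(1) cardS by metis
  next
    case False
    then have nc: "Suc s \<notin> S" if "s \<in> S" for s using that by blast
    have four: "4 \<in> insert x S" using ladder(2)[OF S nc] x(1) by simp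
    have "m = x" if "m \<in> M" "odd m" for m
      using at_most_one_odd[OF x(2) zS cl nc two four] that x(1) by blast
    then show False by (rule not_one_odd)
  qed
qed

section \<open>The three positions of the extra element \<open>t\<close>\<close>

text \<open>A chord \<open>t\<close> excludes both chords 1 and 2, since \<open>t - 1\<close> and
  \<open>t - 2\<close> are at least \<open>d\<close> and so outside \<open>M\<close>; but at most
  one element of \<open>M\<close> is missed.\<close>

lemma has_clique_if_far:
  assumes t: "Suc d < t" and M: "M = insert t {..<d}"
  shows has_clique
proof (rule clique_if_initial_segments)
  fix f assume f: "longest f"
  have sub: "chords f \<subseteq> insert t {..<d}" using chords_subset[OF f] M by simp
  have "t \<notin> chords f"
  proof
    assume tf: "t \<in> chords f"
    have "1 \<notin> chords f \<and> 2 \<notin> chords f"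
      using chords_diff[OF f _ tf] t M d4 by fastforce
    moreover have "1 \<in> M" "2 \<in> M" using M d4 by auto
    ultimately show False using chords_cases[OF f] by (metis insertE numeral_eq_one_iff semiring_norm(85))
  qed
  then have "chords f \<subseteq> {..<d}" using sub by blast
  then show "chords f = {..<d}" using card_chords[OF f] by (intro card_seteq) auto
qed

text \<open>Without the chord \<open>Suc d\<close> only the \<open>d\<close> smaller ones remain.
  Together with it, the chord 1 would give the difference \<open>d\<close>, which is not in
  \<open>M\<close>.\<close>

lemma chords_Suc_d:
  assumes M: "M = insert (Suc d) {..<d}" and f: "longest f" and ne: "chords f \<noteq> {..<d}"
  shows "chords f = M - {1}"
proof -
  have sub: "chords f \<subseteq> insert (Suc d) {..<d}" using chords_subset[OF f] M by simp
  have t: "Suc d \<in> chords f"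
  proof (rule ccontr)
    assume "\<not> ?thesis"
    then have "chords f \<subseteq> {..<d}" using sub by blast
    then show False using card_chords[OF f] ne card_seteq[of "{..<d}" "chords f"] by simp
  qed
  have "1 \<notin> chords f" using chords_diff[OF f _ t, of 1] d4 M by auto
  moreover have "1 \<in> M" using M d4 by auto
  ultimately show ?thesis using chords_cases[OF f] by (metis Diff_insert_absorb insertE)
qed

text \<open>The path \<open>f 0, f 3, f 2, f 4, ..., f (d + 2)\<close> omits only
  \<open>f 1\<close>, and the chord \<open>Suc d\<close> closes it to a cycle of the forbidden
  length \<open>d + 2\<close>.\<close>

lemma has_clique_if_Suc:
  assumes M: "M = insert (Suc d) {..<d}"
  shows has_clique
proof (rule clique_if_initial_segments, rule ccontr)
  fix f assume f: "longest f" and ne: "chords f \<noteq> {..<d}"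
  have cf: "chords f = M - {1}" using chords_Suc_d[OF M f ne] .
  have lf: "s < len" "E (f 0) (f (Suc s))" if "s \<in> M" "s \<noteq> 1" for s
    using that cf by (auto simp: chords_def)
  have in_M: "2 \<in> M" "3 \<in> M" "Suc d \<in> M" using M d4 by auto
  let ?g = "rot 2 f"
  have g: "longest ?g" using rot_longest[OF f] cf in_M by simp
  \<comment> \<open>The rotated path begins with \<open>f 2, f 1, f 0, f 3\<close>, so its chord 1
    would join the same pair \<open>f 0\<close>, \<open>f 2\<close>.\<close>
  have "1 \<notin> chords ?g"
  proof
    assume "1 \<in> chords ?g"
    then have "E (f 2) (f 0)" by (simp add: chords_def rot_def numeral_2_eq_2)
    then have "1 \<in> chords f" using sym lf(1)[OF in_M(1)] by (auto simp: chords_def numeral_2_eq_2)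
    then show False using cf by simp
  qed
  moreover have "1 \<in> {..<d}" using d4 by simp
  ultimately have "chords ?g \<noteq> {..<d}" by metis
  then have "chords ?g = M - {1}" using chords_Suc_d[OF M g] by blast
  then have e24: "E (f 2) (f 4)" using rot_edge[of 3 2 f] in_M by (simp add: numeral_eq_Suc)
  have e03: "E (f 0) (f 3)" using lf(2)[OF in_M(1)] by (simp add: numeral_eq_Suc)
  have e23: "E (f 2) (f 3)" using longest_edge[OF f, of 2] lf(1)[OF in_M(1)] by (simp add: numeral_eq_Suc)
  let ?p = "f 0 # f 3 # f 2 # map f [4..<d + 3]"
  have dl: "Suc d < len" using lf(1)[OF in_M(3)] d4 by simp
  have ne: "f i \<noteq> f j" if "i \<noteq> j" "i < d + 3" "j < d + 3" for i j
    using longest_inj[OF f, of i j] that dl by auto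
  have out: "f i \<notin> set (map f [4..<d + 3])" if "i < 4" for i
  proof
    assume "f i \<in> set (map f [4..<d + 3])"
    then obtain j where "4 \<le> j" "j < d + 3" "f i = f j" by auto
    then show False using ne[of i j] that d4 by auto
  qed
  have "distinct ?p"
    using distinct_map_path[OF f, of "d + 3" 4] dl out[of 0] out[of 2] out[of 3]
      ne[of 0 3] ne[of 0 2] ne[of 3 2] d4 by simp
  moreover have "successively E ?p"
    using successively_map_path[OF f, of "d + 3" 4] dl e03 sym[OF e23] e24 d4
    by (simp add: successively_Cons upt_conv_Cons del: upt_Suc)
  moreover have "last ?p = f (Suc (Suc d))" using d4 by (simp add: numeral_eq_Suc)
  then have "E (last ?p) (hd ?p)" using sym[OF lf(2)[OF in_M(3)]] d4 by simp
  ultimately have "is_cycle E ?p" by (simp add: is_cycle_def)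
  moreover have "set ?p \<subseteq> U" using longest_in[OF f] dl d4 by auto
  ultimately have "length ?p - 2 \<in> M" by (rule cyc)
  moreover have "length ?p - 2 = d" using d4 by simp
  ultimately show False using M by simp
qed

text \<open>The first \<open>d + 1\<close> vertices of a longest path have all their neighbours among the first \<open>d + 2\<close>,
  so the next vertex would be a cut vertex unless there are only \<open>d + 2\<close> vertices; in that case the
  non-edges form a matching, and two of them already give a \<open>d\<close>-colouring.\<close>

lemma has_clique_if_interval:
  assumes M: "M = {..d}"
  shows has_clique
proof (rule ccontr)
  assume no: "\<not> has_clique"
  then obtain f where f: "longest f" and "chords f \<noteq> {..<d}" using clique_if_initial_segments by blast
  then have df: "d \<in> chords f"
    using chords_subset[OF f] card_chords[OF f] card_seteq[of "{..<d}" "chords f"] M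
    by (auto simp: subset_iff nat_less_le)
  then have dl: "d < len" by (simp add: chords_def)
  define W where "W = f ` {..Suc d}"
  define z where "z = f (Suc d)"
  have cardW: "card W = Suc (Suc d)" unfolding W_def using f dl
    by (subst card_image) (auto simp: is_path_def intro: inj_on_subset)
  have WU: "W \<subseteq> U" using longest_in[OF f] dl unfolding W_def by auto
  have zW: "z \<in> W" by (simp add: z_def W_def)
  \<comment> \<open>Rotating at \<open>j \<le> d\<close> only permutes the first
    \<open>d + 2\<close> vertices.\<close>
  have rotW: "rot j g ` {..Suc d} = g ` {..Suc d}" if "j \<le> d" for j g
  proof -
    have "rot j g = g \<circ> (\<lambda>i. if i \<le> j then j - i else i)" by (auto simp: rot_def)
    then have "rot j g ` {..Suc d} = g ` ((\<lambda>i. if i \<le> j then j - i else i) ` {..Suc d})"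
      by (simp only: image_comp)
    moreover have "(\<lambda>i. if i \<le> j then j - i else i) ` {..Suc d} = {..Suc d}"
    proof
      show "{..Suc d} \<subseteq> (\<lambda>i. if i \<le> j then j - i else i) ` {..Suc d}"
      proof
        fix i assume "i \<in> {..Suc d}"
        then show "i \<in> (\<lambda>i. if i \<le> j then j - i else i) ` {..Suc d}"
          using that by (intro image_eqI[of _ _ "if i \<le> j then j - i else i"]) auto
      qed
    qed (use that in auto)
    ultimately show ?thesis by simp
  qed
  have inner: "w \<in> W" if gw: "longest g" "g ` {..Suc d} = W" "w \<in> U" "E (g 0) w" for g w
  proof -
    obtain j where j: "j \<in> chords g" "w = g (Suc j)"
      using neighbour_on_longest[OF gw(1,3,4)] by blast
    then have "j \<le> d" using chords_subset[OF gw(1)] M by auto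
    then have "w \<in> g ` {..Suc d}" using j by simp
    then show ?thesis using gw(2) by simp
  qed
  \<comment> \<open>If the chord \<open>j\<close> is missing, several rotations bring
    \<open>f j\<close> to the front.\<close>
  have start: "\<exists>g. longest g \<and> g ` {..Suc d} = W \<and> g 0 = f j" if "j \<le> d" for j
  proof (cases "j \<in> chords f")
    case True
    then show ?thesis using rot_longest[OF f True] rotW[OF that] W_def
      by (intro exI[of _ "rot j f"]) simp
  next
    case False
    have only: "i \<in> chords f" if "i \<le> d" "i \<noteq> j" for i
      using chords_cases[OF f] False M that \<open>j \<le> d\<close>
      by (metis atMost_iff insertE)
    have "j \<noteq> 0" "j \<noteq> d" using False zero_chords[OF f] df by metis+
    then have j: "0 < j" "j < d" using that by auto
    have not0: "\<not> E (f 0) (f (Suc j))" using False dl that by (simp add: chords_def)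
    \<comment> \<open>\<open>?h\<close> begins with \<open>f (Suc j), f j\<close>. Its chord
      \<open>j\<close> is the same non-edge as before, so it has all other chords, and the chord 1
      leads to \<open>f j\<close>.\<close>
    let ?h = "rot (Suc j) f"
    have h: "longest ?h" "?h ` {..Suc d} = W"
      using rot_longest[OF f only[of "Suc j"]] rotW[of "Suc j" f] j by (auto simp: W_def)
    have "j \<notin> chords ?h"
      using not0 sym[of "f (Suc j)" "f 0"] by (auto simp: chords_def rot_def)
    then have hc: "i \<in> chords ?h" if "i \<le> d" "i \<noteq> j" for i
      using chords_cases[OF h(1)] M that \<open>j \<le> d\<close> by (metis atMost_iff insertE)
    show ?thesis
    proof (cases "j = 1")
      case False
      then have "1 \<in> chords ?h" using hc d4 by simp
      then show ?thesis using rot_longest[OF h(1), of 1] rotW[of 1 ?h] h(2) d4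
        by (intro exI[of _ "rot 1 ?h"]) (auto simp: rot_def)
    next
      case True
      then have h3: "3 \<in> chords ?h" using hc[of 3] d4 by simp
      \<comment> \<open>\<open>?k\<close> begins with \<open>f 3, f 0, f 1, f 2\<close>, so the path
        edge between \<open>f 2\<close> and \<open>f 3\<close> becomes its chord 2, which brings
        \<open>f 1\<close> to the front.\<close>
      let ?k = "rot 3 ?h"
      have k: "longest ?k" "?k ` {..Suc d} = W"
        using rot_longest[OF h(1) h3] rotW[of 3 ?h] h(2) d4 by auto
      have "E (f 3) (f 2)" using sym[OF longest_edge[OF f, of 2]] dl d4 by (simp add: numeral_eq_Suc)
      then have "2 \<in> chords ?k" using True dl d4 by (simp add: chords_def rot_def numeral_eq_Suc)
      then show ?thesis using rot_longest[OF k(1), of 2] rotW[of 2 ?k] k(2) d4 True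
        by (intro exI[of _ "rot 2 ?k"]) (auto simp: rot_def numeral_eq_Suc)
    qed
  qed
  have closed: "w \<in> W" if vw: "v \<in> W - {z}" "w \<in> U" "E v w" for v w
  proof -
    obtain j where "v = f j" "j \<le> d"
      using vw(1) unfolding W_def z_def by (auto simp: le_Suc_eq)
    then show ?thesis using start[of j] inner vw(2,3) by metis
  qed
  have UW: "U = W"
  proof (rule ccontr)
    assume "U \<noteq> W"
    then have "W \<subset> U" using WU by blast
    moreover have "f 0 \<in> W - {z}"
      using longest_inj[OF f, of 0 "Suc d"] dl unfolding W_def z_def by auto
    then have "U - (W - {z}) \<subset> U" using WU by blast
    ultimately have "colourable E W d" "colourable E (U - (W - {z})) d" using crit by blast+
    then have "colourable E (W \<union> (U - (W - {z}))) d"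
      using closed sym zW WU by (intro colourable_glue[where z = z]) (auto simp: symp_def)
    moreover have "W \<union> (U - (W - {z})) = U" using WU by blast
    ultimately show False using not_col by simp
  qed
  have unique: "b = c" if "a \<in> U" "b \<in> U" "c \<in> U" "b \<noteq> a" "c \<noteq> a" "\<not> E a b" "\<not> E a c" for a b c
  proof (rule ccontr)
    assume "b \<noteq> c"
    have "{w \<in> U. E a w} \<subseteq> U - {a, b, c}" using irrefl that by auto
    then have "card {w \<in> U. E a w} \<le> card (U - {a, b, c})" using fin by (intro card_mono) auto
    also have "\<dots> = Suc (Suc d) - 3"
      using cardW UW that \<open>b \<noteq> c\<close> by (subst card_Diff_subset) auto
    finally show False using degree[OF that(1)] d4 by simp
  qed
  have nonedge: "\<exists>a\<in>C. \<exists>b\<in>C. a \<noteq> b \<and> \<not> E a b" if "C \<subseteq> U" "card C = Suc d" for C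
    using no that unfolding has_clique_def by blast
  obtain r where "r \<in> U" using U_nonempty by blast
  then have "card (U - {r}) = Suc d" using cardW UW by simp
  then obtain a b where ab: "a \<in> U" "b \<in> U" "a \<noteq> b" "\<not> E a b" using nonedge[of "U - {r}"] by blast
  \<comment> \<open>Non-edges form a matching by \<open>unique\<close>, so one avoiding
    \<open>a\<close> avoids \<open>b\<close> too.\<close>
  have "card (U - {a}) = Suc d" using cardW UW ab by simp
  then obtain p q where pq: "p \<in> U" "q \<in> U" "p \<noteq> a" "q \<noteq> a" "p \<noteq> q" "\<not> E p q"
    using nonedge[of "U - {a}"] by blast
  have "p \<noteq> b" "q \<noteq> b"
    using unique[of b a q] unique[of b a p] ab pq sym by metis+
  have "card (U - {b, q}) = d"
    using cardW UW ab pq \<open>q \<noteq> b\<close> by (subst card_Diff_subset) auto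
  then obtain c where c: "bij_betw c (U - {b, q}) {0..<d}"
    using ex_bij_betw_finite_nat[of "U - {b, q}"] fin by auto
  \<comment> \<open>The \<open>d\<close> vertices of \<open>U - {b, q}\<close> get distinct colours;
    \<open>b\<close> and \<open>q\<close> repeat the colours of their non-neighbours
    \<open>a\<close> and \<open>p\<close>.\<close>
  define c' where "c' v = (if v = b then c a else if v = q then c p else c v)" for v
  have apU: "a \<in> U - {b, q}" "p \<in> U - {b, q}" using ab pq \<open>p \<noteq> b\<close> by auto
  have lt: "c v < d" if "v \<in> U - {b, q}" for v using bij_betwE[OF c] that by auto
  have inj: "u = v" if "u \<in> U - {b, q}" "v \<in> U - {b, q}" "c u = c v" for u v
    using inj_onD[OF bij_betw_imp_inj_on[OF c] that(3,1,2)] .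
  have "c' v < d" if "v \<in> U" for v using that lt apU by (auto simp: c'_def)
  moreover have "c' u \<noteq> c' v" if "u \<in> U" "v \<in> U" "E u v" for u v
  proof
    assume eq: "c' u = c' v"
    define k where "k w = (if w = b then a else if w = q then p else w)" for w
    have "c' w = c (k w)" for w by (simp add: c'_def k_def)
    moreover have "k w \<in> U - {b, q}" if "w \<in> U" for w using apU that by (auto simp: k_def)
    ultimately have "k u = k v" using inj eq that by metis
    then show False using that irrefl ab(4) pq(3,6) sym
      unfolding k_def by (metis (full_types))
  qed
  ultimately have "colourable E U d" unfolding colourable_def by blast
  then show False using not_col by simp
qed

lemma has_clique: has_clique
proof -
  obtain t where t: "d \<le> t" "M = insert t {..<d}"
    using nearly_initial unfolding nearly_initial_def by blast
  consider "t = d" | "t = Suc d" | "Suc d < t" using t(1) by linarith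
  then show ?thesis
  proof cases
    case 1
    then have "M = {..d}" using t(2) by auto
    then show ?thesis by (rule has_clique_if_interval)
  qed (use has_clique_if_Suc has_clique_if_far t(2) in auto)
qed

end

section \<open>Cycle lengths and the chromatic number\<close>

text \<open>A minimal subset that is not \<open>d\<close>-colourable is vertex-critical.\<close>

lemma clique_or_colourable:
  fixes E :: "'a \<Rightarrow> 'a \<Rightarrow> bool"
  assumes fin: "finite U" and sym: "\<And>u v. E u v \<Longrightarrow> E v u" and irrefl: "\<And>u. \<not> E u u"
    and d4: "4 \<le> d" and L: "finite L" "card L \<le> d"
    and cyc: "\<And>p. is_cycle E p \<Longrightarrow> set p \<subseteq> U \<Longrightarrow> length p \<in> L"
    and not_col: "\<not> colourable E U d"
  shows "\<exists>C\<subseteq>U. card C = Suc d \<and> (\<forall>u\<in>C. \<forall>v\<in>C. u \<noteq> v \<longrightarrow> E u v)"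
proof -
  let ?F = "{W. W \<subseteq> U \<and> \<not> colourable E W d}"
  have "\<exists>W\<in>?F. W \<le> U \<and> (\<forall>V\<in>?F. V \<le> W \<longrightarrow> W = V)"
    using fin not_col by (intro finite_has_minimal2) auto
  then obtain W where W: "W \<subseteq> U" "\<not> colourable E W d"
    and W_min: "\<forall>V\<in>?F. V \<le> W \<longrightarrow> W = V"
    by blast
  have min: "colourable E V d" if "V \<subset> W" for V
    using W_min W(1) that by blast
  define A where "A = insert 0 ((\<lambda>n. n - 2) ` L)"
  have "card A \<le> Suc (card ((\<lambda>n. n - 2) ` L))"
    unfolding A_def using L(1) by (simp add: card_insert_if)
  also have "card ((\<lambda>n. n - 2) ` L) \<le> d" using card_image_le[OF L(1)] L(2) le_trans by blast
  finally have A: "card A \<le> Suc d" "finite A" "0 \<in> A" using L(1) by (auto simp: A_def)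
  \<comment> \<open>Arbitrary numbers \<open>B\<close> pad \<open>A\<close> to the size
    \<open>d + 1\<close> that the locale demands; this merely allows more cycle lengths.\<close>
  have "infinite (UNIV - A)" using A(2) by (simp add: Diff_infinite_finite)
  then obtain B where B: "finite B" "card B = Suc d - card A" "B \<subseteq> UNIV - A"
    using infinite_arbitrarily_large by blast
  have M: "finite (A \<union> B)" "card (A \<union> B) = Suc d"
  proof -
    have "A \<inter> B = {}" using B by blast
    then show "card (A \<union> B) = Suc d" using A B by (simp add: card_Un_disjoint)
  qed (use A B in simp)
  interpret vertex_critical E W d "A \<union> B"
  proof
    show "finite W" using finite_subset[OF W(1) fin] .
    show "length p - 2 \<in> A \<union> B" if "is_cycle E p" "set p \<subseteq> W" for p
    proof -
      have "length p \<in> L" using that W(1) by (intro cyc) auto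
      then show ?thesis unfolding A_def by simp
    qed
    show "E u v \<Longrightarrow> E v u" for u v by (rule sym)
    show "colourable E V d" if "V \<subset> W" for V using that by (rule min)
  qed (rule W(2) irrefl d4 M UnI1[OF A(3)])+
  obtain C where "C \<subseteq> W" "card C = Suc d" "\<forall>u\<in>C. \<forall>v\<in>C. u \<noteq> v \<longrightarrow> E u v"
    using has_clique unfolding has_clique_def by blast
  then show ?thesis using W(1) by (intro exI[of _ C] conjI) auto
qed

text \<open>Walks of the digraph are arc lists; pairing each vertex with its successor gives the
  walk through \<open>ys\<close>.\<close>

lemma walk_of_vertex_list:
  assumes "ys \<noteq> []"
  shows "pcas (hd ys) (zip ys (tl ys)) (last ys)" "pawalk_verts (hd ys) (zip ys (tl ys)) = ys"
    "set (zip ys (tl ys)) \<subseteq> R \<longleftrightarrow> successively (\<lambda>u v. (u, v) \<in> R) ys"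
  using assms by (induction ys rule: induct_list012) auto

lemma cycle_length_of_is_cycle:
  assumes p: "is_cycle (\<lambda>u v. (u, v) \<in> parcs G) p" "set p \<subseteq> pverts G"
  shows "length p \<in> cycle_lengths G"
proof -
  \<comment> \<open>A closed walk returns to its first vertex, which \<open>p\<close> lists only
    once; thus the arcs of \<open>ys\<close> are as many as the vertices of
    \<open>p\<close>.\<close>
  define ys where "ys = p @ [hd p]"
  have pne: "p \<noteq> []" using p(1) by (auto simp: is_cycle_def)
  then have ys: "ys \<noteq> []" "hd ys = hd p" "last ys = hd p" "tl ys = tl p @ [hd p]"
    by (simp_all add: ys_def)
  let ?q = "zip ys (tl ys)"
  have len: "length ?q = length p" using pne by (simp add: ys_def)
  have "successively (\<lambda>u v. (u, v) \<in> parcs G) ys"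
    using p(1) pne by (simp add: is_cycle_def ys_def successively_append_iff)
  then have "set ?q \<subseteq> parcs G" using walk_of_vertex_list(3)[OF ys(1)] by blast
  moreover have "hd p \<in> pverts G" using p(2) pne by auto
  ultimately have "pre_digraph.awalk (with_proj G) (hd p) ?q (hd p)"
    using walk_of_vertex_list(1)[OF ys(1)] ys
    by (simp add: pre_digraph.awalk_def cas_with_proj_eq)
  moreover have "distinct (tl p @ [hd p])" using p(1) pne by (cases p) (auto simp: is_cycle_def)
  then have "distinct (tl (pre_digraph.awalk_verts (with_proj G) (hd p) ?q))"
    using walk_of_vertex_list(2)[OF ys(1)] ys by (simp add: awalk_verts_with_proj_eq)
  moreover have "?q \<noteq> []" using len pne by (metis length_0_conv)
  ultimately have "pre_digraph.cycle (with_proj G) ?q" unfolding pre_digraph.cycle_def by blast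
  moreover have "3 \<le> length ?q" using p(1) len by (simp add: is_cycle_def)
  ultimately show ?thesis using len unfolding cycle_lengths_def by force
qed

theorem theorem11:
  fixes G :: "'a pair_pre_digraph" and i :: nat
  assumes "pair_graph G"
    and "connected (with_proj G)"
    and "card (cycle_lengths G) \<ge> 4"
    and "i \<in> {0, 1, 2}"
    and "\<not> (i = 0 \<and> card (odd_cycle_lengths G) = 3 \<and> card (even_cycle_lengths G) = 2)"
    and "clique_number G \<le> card (cycle_lengths G) + i"
  shows "chromatic_number G \<le> card (cycle_lengths G) + i"
proof (rule ccontr)
  interpret pair_graph G by fact
  let ?E = "\<lambda>u v. (u, v) \<in> parcs G"
  let ?k = "card (cycle_lengths G) + i"
  assume large: "\<not> chromatic_number G \<le> ?k"
  have "\<not> colourable ?E (pverts G) ?k"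
  proof
    assume "colourable ?E (pverts G) ?k"
    then obtain c :: "'a \<Rightarrow> nat" where c: "\<forall>v\<in>pverts G. c v < ?k"
      "\<forall>u\<in>pverts G. \<forall>v\<in>pverts G. ?E u v \<longrightarrow> c u \<noteq> c v"
      unfolding colourable_def by auto
    have "c u \<noteq> c v" if "?E u v" for u v
      using c(2) that in_arcsD1[OF that] in_arcsD2[OF that] by blast
    then have "proper_colouring G ?k c" using c(1) unfolding proper_colouring_def by blast
    then have "chromatic_number G \<le> ?k"
      unfolding chromatic_number_def by (intro Least_le exI)
    then show False using large by simp
  qed
  then have "\<exists>C\<subseteq>pverts G. card C = Suc ?k \<and> (\<forall>u\<in>C. \<forall>v\<in>C. u \<noteq> v \<longrightarrow> ?E u v)"
  proof (rule clique_or_colourable[rotated -1])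
    show "?E v u" if "?E u v" for u v using that by (rule arcs_symmetric)
    show "\<not> ?E u u" for u using pair_no_loops[of "(u, u)"] by auto
    show "length p \<in> cycle_lengths G" if "is_cycle ?E p" "set p \<subseteq> pverts G" for p
      using that by (rule cycle_length_of_is_cycle)
  qed (use assms(3) finite_cycle_lengths[OF assms(1)] in simp_all)
  then obtain C where C: "C \<subseteq> pverts G" "card C = Suc ?k"
    "\<forall>u\<in>C. \<forall>v\<in>C. u \<noteq> v \<longrightarrow> ?E u v"
    by auto
  then have "clique G C" by (simp add: clique_def)
  then have "card C \<le> clique_number G"
    using finite_clique_sizes(1)[OF assms(1)] unfolding clique_number_def by (intro Max_ge) auto
  then show False using C(2) assms(6) by simp
qed

end
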